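(* Let $f:\mathbb{R}^n\to\mathbb{R}$ be continuously differentiable, strongly convex with parameter $\rho>0$ and strongly smooth with parameter $\ell$. Let $g:\mathbb{R}^m\to[-\infty,+\infty]$ be convex, closed, and proper, and let $A\in\mathbb{R}^{m\times n}$ satisfy $a_{\min}I_m\preceq AA^\top\preceq a_{\max}I_m$ for some $a_{\min},a_{\max}>0$. Let $\gamma>0$ be arbitrary and let $\varepsilon\in\,]0,1/\sqrt{a_{\max}}[$. Then the primal-dual dynamics $$\dot x=-\nabla f(x)-A^\top\nabla M_{\gamma g}(Ax+\gamma\lambda),\qquad \dot\lambda=\gamma\bigl(-\lambda+\nabla M_{\gamma g}(Ax+\gamma\lambda)\bigr)$$ on $\mathbb{R}^n\times\mathbb{R}^m$ are strongly infinitesimally contracting with respect to $\|\cdot\|_P$ with rate $c^\star>0$, where $$P=\begin{bmatrix}I_n&\alpha^\star A^\top\\ \alpha^\star A&I_m\end{bmatrix}$$ and $\alpha^\star>0$, $c^\star>0$ are the arguments solving the nonlinear program $(\mathrm{NLP})$ described in the context.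
   Context: The nonlinear program $(\mathrm{NLP})$, for given $\rho,\ell,a_{\min},a_{\max},\gamma,\varepsilon$, is $$\max_{c\ge0,\ \alpha\ge0,\ \varkappa\ge0}\ c$$ subject to $$\alpha\le\min\Big\{\tfrac1{\sqrt{a_{\max}}}-\varepsilon,\ \tfrac{\gamma}{a_{\max}}\Big\},\qquad \varkappa\ge\tfrac23,\qquad c\le\Big(\tfrac34-\tfrac1{2\varkappa}\Big)\alpha a_{\min},\qquad h(c,\alpha,\varkappa)\ge0,$$ where, with $\mathrm{ReLU}(x)=\max\{0,x\}$, $$h(c,\alpha,\varkappa)=2\rho-\mathrm{ReLU}\Big(2\alpha-\tfrac2\gamma\Big)a_{\max}-2c-\alpha\varkappa\frac{a_{\max}}{a_{\min}}\Big(\gamma^2\frac{a_{\max}}{a_{\min}}+\big(\ell+\tfrac{a_{\max}}{\gamma}+2c\big)^2+2\gamma\frac{a_{\max}}{a_{\min}}\big(\ell+\tfrac{a_{\max}}{\gamma}+2c\big)\Big).$$ An optimal solution is denoted $(c^\star,\alpha^\star,\varkappa^\star)$. $f$ is strongly convex with parameter $\rho$ if $x\mapsto f(x)-\frac\rho2\|x\|_2^2$ is convex, and strongly smooth with parameter $\ell$ if $\nabla f$ is Lipschitz on $(\mathbb{R}^n,\|\cdot\|_2)$ with constant $\ell$. Proper: never $-\infty$ and finite somewhere; closed: closed epigraph. $\operatorname{prox}_{\gamma g}(x)=\operatorname{argmin}_z g(z)+\frac1{2\gamma}\|x-z\|_2^2$; the Moreau envelope is $M_{\gamma g}(x)=g(\operatorname{prox}_{\gamma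 g}(x))+\frac1{2\gamma}\|x-\operatorname{prox}_{\gamma g}(x)\|_2^2$, with gradient $\nabla M_{\gamma g}(x)=\frac1\gamma(x-\operatorname{prox}_{\gamma g}(x))$. For symmetric positive definite $P$, $\|z\|_P=\sqrt{z^\top Pz}$. Dynamics $\dot z=G(z)$ with $G$ continuous are strongly infinitesimally contracting with respect to $\|\cdot\|_P$ with rate $c>0$ if $(G(z_1)-G(z_2))^\top P(z_1-z_2)\le -c\|z_1-z_2\|_P^2$ for all $z_1,z_2$. *)

theory Defs
  imports "HOL-Analysis.Analysis"
begin

section \<open>Differentiable functions\<close>

text \<open>Only meaningful where \<open>f\<close> is differentiable; there it is the unique \<open>D\<close>
  with \<open>GDERIV f x :> D\<close>.\<close>

definition gradient :: "('a::real_inner \<Rightarrow> real) \<Rightarrow> 'a \<Rightarrow> 'a" where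
  "gradient f x = (THE D. GDERIV f x :> D)"

definition continuously_differentiable :: "('a::euclidean_space \<Rightarrow> real) \<Rightarrow> bool" where
  "continuously_differentiable f \<longleftrightarrow>
     (\<forall>x. f differentiable (at x)) \<and> continuous_on UNIV (gradient f)"

definition strongly_convex :: "real \<Rightarrow> ('a::euclidean_space \<Rightarrow> real) \<Rightarrow> bool" where
  "strongly_convex \<rho> f \<longleftrightarrow> convex_on UNIV (\<lambda>x. f x - \<rho> / 2 * (norm x)\<^sup>2)"

definition strongly_smooth :: "real \<Rightarrow> ('a::euclidean_space \<Rightarrow> real) \<Rightarrow> bool" where
  "strongly_smooth L f \<longleftrightarrow> L-lipschitz_on UNIV (gradient f)"


section \<open>Extended-real-valued functions\<close>

definition ereal_epigraph :: "('a \<Rightarrow> ereal) \<Rightarrow> ('a \<times> real) set" where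
  "ereal_epigraph g = {(x, r). g x \<le> ereal r}"

definition convex_ereal :: "('a::euclidean_space \<Rightarrow> ereal) \<Rightarrow> bool" where
  "convex_ereal g \<longleftrightarrow> convex (ereal_epigraph g)"

definition closed_ereal :: "('a::euclidean_space \<Rightarrow> ereal) \<Rightarrow> bool" where
  "closed_ereal g \<longleftrightarrow> closed (ereal_epigraph g)"

definition proper_ereal :: "('a \<Rightarrow> ereal) \<Rightarrow> bool" where
  "proper_ereal g \<longleftrightarrow> (\<forall>x. g x \<noteq> -\<infinity>) \<and> (\<exists>x. \<bar>g x\<bar> \<noteq> \<infinity>)"

definition prox :: "real \<Rightarrow> ('a::euclidean_space \<Rightarrow> ereal) \<Rightarrow> 'a \<Rightarrow> 'a" where
  "prox \<gamma> g x = (ARG_MIN (\<lambda>z. g z + ereal (1 / (2 * \<gamma>) * (norm (x - z))\<^sup>2)) z. True)"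

text \<open>The extended-real value is finite when \<open>g\<close> is convex, closed and proper and \<open>\<gamma> > 0\<close>,
  so the conversion to \<^typ>\<open>real\<close> loses nothing in that case.\<close>

definition moreau_envelope :: "real \<Rightarrow> ('a::euclidean_space \<Rightarrow> ereal) \<Rightarrow> 'a \<Rightarrow> real" where
  "moreau_envelope \<gamma> g x =
     real_of_ereal (g (prox \<gamma> g x) + ereal (1 / (2 * \<gamma>) * (norm (x - prox \<gamma> g x))\<^sup>2))"


section \<open>Symmetric matrices\<close>

definition pos_semidef :: "real^'k^'k \<Rightarrow> bool" where
  "pos_semidef M \<longleftrightarrow> transpose M = M \<and> (\<forall>x. 0 \<le> x \<bullet> (M *v x))"

definition pos_def :: "real^'k^'k \<Rightarrow> bool" where
  "pos_def M \<longleftrightarrow> transpose M = M \<and> (\<forall>x. x \<noteq> 0 \<longrightarrow> 0 < x \<bullet> (M *v x))"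

definition loewner_le :: "real^'k^'k \<Rightarrow> real^'k^'k \<Rightarrow> bool" (infix "\<preceq>" 50) where
  "X \<preceq> Y \<longleftrightarrow> pos_semidef (Y - X)"

definition weighted_norm :: "real^'k^'k \<Rightarrow> real^'k \<Rightarrow> real" where
  "weighted_norm P z = sqrt (z \<bullet> (P *v z))"


section \<open>Block vectors and block matrices\<close>

text \<open>The space \<open>\<real>\<^sup>n \<times> \<real>\<^sup>m\<close> is rendered as vectors indexed by the disjoint sum of the two
  index types, so that \<open>P\<close> is a genuine square matrix.\<close>

definition join_vec :: "'a^'n \<Rightarrow> 'a^'m \<Rightarrow> 'a^('n + 'm)" where
  "join_vec x y = (\<chi> i. case i of Inl j \<Rightarrow> x $ j | Inr k \<Rightarrow> y $ k)"

definition left_vec :: "'a^('n::finite + 'm::finite) \<Rightarrow> 'a^'n" where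
  "left_vec z = (\<chi> j. z $ Inl j)"

definition right_vec :: "'a^('n::finite + 'm::finite) \<Rightarrow> 'a^'m" where
  "right_vec z = (\<chi> k. z $ Inr k)"

definition block_matrix ::
  "'a^'n^'n \<Rightarrow> 'a^'m^'n \<Rightarrow> 'a^'n^'m \<Rightarrow> 'a^'m^'m \<Rightarrow> 'a^('n + 'm)^('n + 'm)" where
  "block_matrix M11 M12 M21 M22 =
     (\<chi> i. case i of Inl j \<Rightarrow> join_vec (M11 $ j) (M12 $ j)
                    | Inr k \<Rightarrow> join_vec (M21 $ k) (M22 $ k))"


section \<open>Contraction and the primal-dual dynamics\<close>

definition strongly_inf_contracting ::
  "real^'k^'k \<Rightarrow> real \<Rightarrow> (real^'k \<Rightarrow> real^'k) \<Rightarrow> bool" where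
  "strongly_inf_contracting P c G \<longleftrightarrow>
     pos_def P \<and> c > 0 \<and> continuous_on UNIV G \<and>
     (\<forall>z1 z2. (G z1 - G z2) \<bullet> (P *v (z1 - z2)) \<le> - c * (weighted_norm P (z1 - z2))\<^sup>2)"

definition primal_dual_dynamics ::
  "(real^'n \<Rightarrow> real) \<Rightarrow> (real^'m \<Rightarrow> ereal) \<Rightarrow> real^'n^'m \<Rightarrow> real \<Rightarrow>
     real^('n + 'm) \<Rightarrow> real^('n + 'm)" where
  "primal_dual_dynamics f g A \<gamma> z =
     (let x = left_vec z; lam = right_vec z;
          v = gradient (moreau_envelope \<gamma> g) (A *v x + \<gamma> *\<^sub>R lam)
      in join_vec (- gradient f x - transpose A *v v) (\<gamma> *\<^sub>R (- lam + v)))"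

definition contraction_metric :: "real^'n^'m \<Rightarrow> real \<Rightarrow> real^('n + 'm)^('n + 'm)" where
  "contraction_metric A \<alpha> =
     block_matrix (mat 1) (\<alpha> *\<^sub>R transpose A) (\<alpha> *\<^sub>R A) (mat 1)"


section \<open>The nonlinear program\<close>

definition ReLU :: "real \<Rightarrow> real" where
  "ReLU x = max 0 x"

definition nlp_h ::
  "real \<Rightarrow> real \<Rightarrow> real \<Rightarrow> real \<Rightarrow> real \<Rightarrow> real \<Rightarrow> real \<Rightarrow> real \<Rightarrow> real" where
  "nlp_h \<rho> L amin amax \<gamma> c \<alpha> \<kappa> =
     2 * \<rho> - ReLU (2 * \<alpha> - 2 / \<gamma>) * amax - 2 * c
     - \<alpha> * \<kappa> * (amax / amin) *
       (\<gamma>\<^sup>2 * (amax / amin) + (L + amax / \<gamma> + 2 * c)\<^sup>2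
        + 2 * \<gamma> * (amax / amin) * (L + amax / \<gamma> + 2 * c))"

definition nlp_feasible ::
  "real \<Rightarrow> real \<Rightarrow> real \<Rightarrow> real \<Rightarrow> real \<Rightarrow> real \<Rightarrow> real \<times> real \<times> real \<Rightarrow> bool" where
  "nlp_feasible \<rho> L amin amax \<gamma> \<epsilon> = (\<lambda>(c, \<alpha>, \<kappa>).
     c \<ge> 0 \<and> \<alpha> \<ge> 0 \<and> \<kappa> \<ge> 0 \<and>
     \<alpha> \<le> min (1 / sqrt amax - \<epsilon>) (\<gamma> / amax) \<and>
     \<kappa> \<ge> 2 / 3 \<and>
     c \<le> (3 / 4 - 1 / (2 * \<kappa>)) * \<alpha> * amin \<and>
     nlp_h \<rho> L amin amax \<gamma> c \<alpha> \<kappa> \<ge> 0)"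

definition nlp_optimal ::
  "real \<Rightarrow> real \<Rightarrow> real \<Rightarrow> real \<Rightarrow> real \<Rightarrow> real \<Rightarrow> real \<times> real \<times> real \<Rightarrow> bool" where
  "nlp_optimal \<rho> L amin amax \<gamma> \<epsilon> =
     is_arg_max (\<lambda>(c, \<alpha>, \<kappa>). c) (nlp_feasible \<rho> L amin amax \<gamma> \<epsilon>)"

end

theory Submission
  imports Defs
begin

text \<open>
  The dynamics are a gradient flow in \<open>x\<close> coupled to a flow in \<open>\<lambda>\<close> that is damped only partially
  on its own: where the Moreau envelope has full curvature \<open>1 / \<gamma>\<close>, the equation for \<open>\<lambda>\<close> contains no
  damping term at all. The cross term \<open>\<alpha> A\<close> in the metric \<open>P\<close> repairs this, because it lets \<open>\<lambda>\<close> inherit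
  damping of size \<open>\<alpha> A A\<^sup>T\<close> through \<open>x\<close>.

  Let \<open>x\<close>, \<open>y\<close> be the primal and dual differences of two states, \<open>p\<close> the difference of the gradients
  of \<open>f\<close>, and \<open>v\<close> that of the gradients of the envelope at points which differ by
  \<open>u = A x + \<gamma> y\<close>. Only three properties of the nonlinear terms matter:
  \<open>p \<bullet> x \<ge> \<rho> \<parallel>x\<parallel>\<^sup>2\<close> from strong convexity, \<open>\<parallel>p\<parallel> \<le> L \<parallel>x\<parallel>\<close> from smoothness, and cocoercivity
  \<open>v \<bullet> u \<ge> \<gamma> \<parallel>v\<parallel>\<^sup>2\<close>, which is firm nonexpansiveness of the proximal operator
  (\<open>gradient_moreau_envelope_cocoercive\<close>). A single cocoercive
  pair can be written \<open>v = G u\<close> with \<open>G\<close> symmetric and \<open>0 \<preceq> G \<preceq> I / \<gamma>\<close>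
  (\<open>cocoercive_pair_symmetric_operator\<close>), and this \<open>G\<close> stands in for the Hessian of the envelope:
  substituting it splits the contraction inequality into a primal, a dual and an off-diagonal
  block, as for a quadratic form in \<open>(x, y)\<close>.

  Its primal diagonal block is at least \<open>a = 2 \<rho> - ReLU (2 \<alpha> - 2 / \<gamma>) amax - 2 c\<close>. Its dual block is at
  least \<open>3/2 \<alpha> amin - 2 c\<close> by \<open>dual_block_lower_bound\<close>, hence at least \<open>b = \<alpha> amin / \<kappa>\<close> by the
  constraint on \<open>c\<close>; so \<open>\<kappa>\<close> is the share of the dual damping that is kept for the coupling. The
  off-diagonal block has norm at most \<open>\<alpha> sqrt amax K\<close> with \<open>K = \<gamma> + L + amax / \<gamma> + 2 c\<close>. The
  constraint \<open>h \<ge> 0\<close> implies the Schur complement condition \<open>(\<alpha> sqrt amax K)\<^sup>2 \<le> a b\<close>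
  (\<open>nlp_feasible_schur\<close>), and \<open>primal_dual_dissipation\<close> combines the three bounds. Thus any feasible point
  with \<open>\<alpha> > 0\<close> and \<open>c > 0\<close> yields contraction.

  The program has feasible points with \<open>c > 0\<close>, because \<open>h\<close> is close to \<open>2 \<rho>\<close> when \<open>\<alpha>\<close> and \<open>c\<close> are small.
  The feasible points that are at least as good as one of these form a compact set, so an optimum is
  attained, and there \<open>c\<close> and therefore \<open>\<alpha>\<close> are positive.
\<close>


section \<open>Gradients of convex functions\<close>

lemma gradient_eqI:
  assumes "GDERIV f x :> D"
  shows "gradient f x = D"
  unfolding gradient_def
proof (rule the_equality)
  show "GDERIV f x :> D"
    by (rule assms)
next
  fix D' assume "GDERIV f x :> D'"
  then have "(\<lambda>h. h \<bullet> D') = (\<lambda>h. h \<bullet> D)"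
    using assms has_derivative_unique unfolding gderiv_def by blast
  then show "D' = D"
    by (metis inner_commute vector_eq_rdot)
qed

lemma GDERIV_gradient:
  fixes f :: "'a::euclidean_space \<Rightarrow> real"
  assumes "f differentiable (at x)"
  shows "GDERIV f x :> gradient f x"
proof -
  obtain f' where f': "(f has_derivative f') (at x)"
    using assms differentiable_def by blast
  define D where "D = (\<Sum>b\<in>Basis. f' b *\<^sub>R b)"
  have lin: "linear f'"
    using f' has_derivative_linear by blast
  have "f' h = h \<bullet> D" for h
  proof -
    have "f' h = f' (\<Sum>b\<in>Basis. (h \<bullet> b) *\<^sub>R b)"
      by (simp add: euclidean_representation)
    also have "\<dots> = (\<Sum>b\<in>Basis. (h \<bullet> b) * f' b)"
      using lin by (simp add: linear_sum linear_cmul)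
    also have "\<dots> = h \<bullet> D"
      by (simp add: D_def inner_sum_right mult.commute)
    finally show ?thesis .
  qed
  then have "f' = (\<lambda>h. h \<bullet> D)"
    by blast
  then have "GDERIV f x :> D"
    using f' by (simp add: gderiv_def)
  then show ?thesis
    using gradient_eqI by metis
qed

text \<open>Restricting to the line through \<open>x\<close> and \<open>y\<close> reduces the tangent inequality to that of a
  convex function of one real variable.\<close>

lemma convex_on_above_tangent_GDERIV:
  fixes F :: "'a::real_inner \<Rightarrow> real"
  assumes conv: "convex_on UNIV F" and D: "GDERIV F x :> D"
  shows "F x + D \<bullet> (y - x) \<le> F y"
proof -
  define \<phi> where "\<phi> = (\<lambda>t. F (x + t *\<^sub>R (y - x)))"
  have "\<phi> (\<mu> * s + (1 - \<mu>) * t) \<le> \<mu> * \<phi> s + (1 - \<mu>) * \<phi> t"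
    if "\<mu> \<ge> 0 \<and> \<mu> \<le> 1" for s t \<mu>
  proof -
    have "x + (\<mu> * s + (1 - \<mu>) * t) *\<^sub>R (y - x)
        = \<mu> *\<^sub>R (x + s *\<^sub>R (y - x)) + (1 - \<mu>) *\<^sub>R (x + t *\<^sub>R (y - x))"
      by (simp add: algebra_simps)
    then show ?thesis
      using conv that by (simp add: convex_on_alt \<phi>_def)
  qed
  then have "convex_on UNIV \<phi>"
    by (simp add: convex_on_alt)
  moreover have "(\<phi> has_field_derivative D \<bullet> (y - x)) (at 0)"
  proof -
    have "((\<lambda>t. x + t *\<^sub>R (y - x)) has_derivative (\<lambda>t. t *\<^sub>R (y - x))) (at 0)"
      by (auto intro!: derivative_eq_intros)
    moreover have "(F has_derivative (\<lambda>h. h \<bullet> D)) (at (x + 0 *\<^sub>R (y - x)))"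
      using D by (simp add: gderiv_def)
    ultimately have "(\<phi> has_derivative (\<lambda>t. (t *\<^sub>R (y - x)) \<bullet> D)) (at 0)"
      unfolding \<phi>_def by (rule has_derivative_compose)
    then show ?thesis
      by (simp add: has_field_derivative_def inner_commute mult.commute[of _ "D \<bullet> (y - x)"]
          mult_commute_abs)
  qed
  ultimately have "\<phi> 1 - \<phi> 0 \<ge> D \<bullet> (y - x) * (1 - 0)"
    by (intro convex_on_imp_above_tangent) auto
  then show ?thesis
    by (simp add: \<phi>_def)
qed

text \<open>The two tangent inequalities of \<open>f - \<rho>/2 \<parallel>\<cdot>\<parallel>\<^sup>2\<close>, at \<open>x\<close> and at \<open>y\<close>, add up to strong
  monotonicity of the gradient.\<close>

lemma strongly_convex_imp_gradient_strongly_monotone: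
  assumes sc: "strongly_convex \<rho> f" and diff: "\<And>x. f differentiable (at x)"
  shows "\<rho> * (norm (x - y))\<^sup>2 \<le> (gradient f x - gradient f y) \<bullet> (x - y)"
proof -
  have D: "GDERIV (\<lambda>x. f x - \<rho> / 2 * (norm x)\<^sup>2) z :> gradient f z - \<rho> *\<^sub>R z" for z
  proof -
    have "GDERIV (\<lambda>x. \<rho> / 2 * (norm x)\<^sup>2) z :> \<rho> *\<^sub>R z"
      unfolding gderiv_def power2_norm_eq_inner
      by (auto intro!: derivative_eq_intros simp: inner_commute)
    then show ?thesis
      by (intro GDERIV_diff GDERIV_gradient diff)
  qed
  have "f a - \<rho> / 2 * (norm a)\<^sup>2 + (gradient f a - \<rho> *\<^sub>R a) \<bullet> (b - a) \<le> f b - \<rho> / 2 * (norm b)\<^sup>2"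
    for a b
    using convex_on_above_tangent_GDERIV[OF _ D] sc unfolding strongly_convex_def by blast
  from this[of x y] this[of y x] show ?thesis
    unfolding power2_norm_eq_inner by (simp add: algebra_simps inner_commute)
qed


section \<open>Proximal operators and Moreau envelopes\<close>

context
  fixes g :: "'a::euclidean_space \<Rightarrow> ereal" and \<gamma> :: real
  assumes convex_g: "convex_ereal g" and closed_g: "closed_ereal g" and proper_g: "proper_ereal g"
    and \<gamma>_pos: "\<gamma> > 0"
begin

lemma finite_somewhere: "\<exists>z r. g z = ereal r"
  using proper_g unfolding proper_ereal_def by (metis ereal_real')

text \<open>A hyperplane that strictly separates the epigraph from a point just below its graph cannot
  be vertical, since the graph point lies right above; so it is the graph of an affine minorant.\<close>

lemma affine_minorant_exists:
  "\<exists>a b. \<forall>z r. g z \<le> ereal r \<longrightarrow> a \<bullet> z + b \<le> r"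
proof -
  obtain z0 r0 where r0: "g z0 = ereal r0"
    using finite_somewhere by blast
  then have "(z0, r0 - 1) \<notin> ereal_epigraph g" and in_epi: "(z0, r0) \<in> ereal_epigraph g"
    by (auto simp: ereal_epigraph_def)
  then obtain d \<beta> where sep0: "d \<bullet> (z0, r0 - 1) < \<beta>"
      and sep: "\<forall>e\<in>ereal_epigraph g. d \<bullet> e > \<beta>"
    using separating_hyperplane_closed_point[of "ereal_epigraph g" "(z0, r0 - 1)"]
      convex_g closed_g unfolding convex_ereal_def closed_ereal_def by blast
  obtain a s where d: "d = (a, s)"
    by force
  have "a \<bullet> z0 + s * r0 > \<beta>" and "a \<bullet> z0 + s * (r0 - 1) < \<beta>"
    using sep in_epi sep0 by (auto simp: d)
  then have "s > 0"
    by (simp add: algebra_simps)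
  have "(- (1 / s) *\<^sub>R a) \<bullet> z + \<beta> / s \<le> r" if "g z \<le> ereal r" for z r
  proof -
    have "a \<bullet> z + s * r > \<beta>"
      using sep that by (auto simp: d ereal_epigraph_def)
    then show ?thesis
      using \<open>s > 0\<close> by (simp add: field_simps)
  qed
  then show ?thesis
    by blast
qed

text \<open>The affine minorant makes the proximal objective coercive on the closed epigraph, so its
  infimum over the epigraph is taken on a compact part.\<close>

lemma prox_objective_attains_min:
  "\<exists>p. \<forall>z. g p + ereal (1 / (2 * \<gamma>) * (norm (x - p))\<^sup>2)
           \<le> g z + ereal (1 / (2 * \<gamma>) * (norm (x - z))\<^sup>2)"
proof -
  define k where "k = 1 / (2 * \<gamma>)"
  have "k > 0"
    using \<gamma>_pos by (simp add: k_def)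
  define q where "q = (\<lambda>e::'a \<times> real. snd e + k * (norm (x - fst e))\<^sup>2)"
  obtain a b where minorant: "\<And>z r. g z \<le> ereal r \<Longrightarrow> a \<bullet> z + b \<le> r"
    using affine_minorant_exists by blast
  obtain z0 r0 where r0: "g z0 = ereal r0"
    using finite_somewhere by blast
  define q0 where "q0 = q (z0, r0)"
  define S where "S = ereal_epigraph g \<inter> {e. q e \<le> q0}"
  define C where "C = q0 - b - a \<bullet> x"
  define B where "B = (norm a + \<bar>C\<bar>) / k + 1"
  have contq: "continuous_on T q" for T
    unfolding q_def by (intro continuous_intros)
  have "S \<subseteq> cball x B \<times> {a \<bullet> x - norm a * B + b..q0}"
  proof
    fix e assume "e \<in> S"
    then obtain z r where e: "e = (z, r)" and gz: "g z \<le> ereal r"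
      and le: "r + k * (norm (x - z))\<^sup>2 \<le> q0"
      by (cases e) (auto simp: S_def ereal_epigraph_def q_def)
    define n where "n = norm (x - z)"
    have az: "a \<bullet> z \<ge> a \<bullet> x - norm a * n"
      using norm_cauchy_schwarz[of a "x - z"] by (simp add: n_def inner_diff_right)
    have "n \<le> B"
    proof (rule ccontr)
      assume "\<not> n \<le> B"
      then have "n > B" by simp
      have "B \<ge> 1"
        using \<open>k > 0\<close> by (simp add: B_def)
      have "norm a + \<bar>C\<bar> < k * n"
        using \<open>n > B\<close> \<open>k > 0\<close> by (simp add: B_def field_simps)
      then have "(norm a + \<bar>C\<bar>) * n < k * n * n"
        using \<open>n > B\<close> \<open>B \<ge> 1\<close> by (intro mult_strict_right_mono) auto
      moreover have "\<bar>C\<bar> * 1 \<le> \<bar>C\<bar> * n"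
        using \<open>n > B\<close> \<open>B \<ge> 1\<close> by (intro mult_left_mono) auto
      moreover have "k * n * n \<le> C + norm a * n"
        using le minorant[OF gz] az by (simp add: C_def n_def power2_eq_square)
      ultimately show False
        by (simp add: algebra_simps)
    qed
    then have "norm a * n \<le> norm a * B"
      by (intro mult_left_mono) auto
    moreover have "k * (norm (x - z))\<^sup>2 \<ge> 0"
      using \<open>k > 0\<close> by simp
    ultimately show "e \<in> cball x B \<times> {a \<bullet> x - norm a * B + b..q0}"
      using \<open>n \<le> B\<close> az minorant[OF gz] le by (simp add: e n_def dist_norm)
  qed
  moreover have "closed S"
    unfolding S_def using closed_g unfolding closed_ereal_def
    by (intro closed_Int closed_Collect_le contq continuous_on_const) auto
  moreover have "compact (cball x B \<times> {a \<bullet> x - norm a * B + b..q0})"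
    by (intro compact_Times) auto
  ultimately have "compact S"
    using compact_Int_closed inf.absorb_iff2 by metis
  moreover have "(z0, r0) \<in> S"
    by (simp add: S_def ereal_epigraph_def r0 q0_def)
  ultimately obtain e where e: "e \<in> S" "\<And>e'. e' \<in> S \<Longrightarrow> q e \<le> q e'"
    using continuous_attains_inf[OF _ _ contq, of S] by blast
  have "g (fst e) + ereal (k * (norm (x - fst e))\<^sup>2) \<le> g z + ereal (k * (norm (x - z))\<^sup>2)" for z
  proof (cases "g z")
    case (real s)
    have "q e \<le> q (z, s)"
    proof (cases "q (z, s) \<le> q0")
      case True
      then show ?thesis
        using e(2) real by (simp add: S_def ereal_epigraph_def)
    next
      case False
      then show ?thesis
        using e(1) by (auto simp: S_def)
    qed
    moreover have "g (fst e) \<le> ereal (snd e)"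
      using e(1) by (auto simp: S_def ereal_epigraph_def)
    then have "g (fst e) + ereal (k * (norm (x - fst e))\<^sup>2) \<le> ereal (q e)"
      using add_right_mono[of "g (fst e)" "ereal (snd e)" "ereal (k * (norm (x - fst e))\<^sup>2)"]
      by (simp add: q_def)
    ultimately show ?thesis
      using real order_trans by (fastforce simp: q_def)
  next
    case PInf
    then show ?thesis by simp
  next
    case MInf
    then show ?thesis
      using proper_g by (simp add: proper_ereal_def)
  qed
  then show ?thesis
    unfolding k_def by blast
qed

lemma prox_minimizes:
  "g (prox \<gamma> g x) + ereal (1 / (2 * \<gamma>) * (norm (x - prox \<gamma> g x))\<^sup>2)
     \<le> g z + ereal (1 / (2 * \<gamma>) * (norm (x - z))\<^sup>2)"
proof -
  let ?F = "\<lambda>z. g z + ereal (1 / (2 * \<gamma>) * (norm (x - z))\<^sup>2)"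
  obtain p where "\<And>z. ?F p \<le> ?F z"
    using prox_objective_attains_min[of x] by blast
  then have "is_arg_min ?F (\<lambda>z. True) p"
    by (simp add: is_arg_min_def not_less)
  then have "is_arg_min ?F (\<lambda>z. True) (prox \<gamma> g x)"
    unfolding prox_def arg_min_def by (rule someI)
  then show ?thesis
    by (simp add: is_arg_min_def not_less)
qed

lemma finite_at_prox: "g (prox \<gamma> g x) = ereal (real_of_ereal (g (prox \<gamma> g x)))"
proof -
  obtain z0 r0 where "g z0 = ereal r0"
    using finite_somewhere by blast
  then have "g (prox \<gamma> g x) \<noteq> \<infinity>"
    using prox_minimizes[of x z0] by auto
  moreover have "g (prox \<gamma> g x) \<noteq> -\<infinity>"
    using proper_g by (simp add: proper_ereal_def)
  ultimately show ?thesis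
    by (cases "g (prox \<gamma> g x)") auto
qed

lemma moreau_envelope_eq:
  "moreau_envelope \<gamma> g x
     = real_of_ereal (g (prox \<gamma> g x)) + 1 / (2 * \<gamma>) * (norm (x - prox \<gamma> g x))\<^sup>2"
  unfolding moreau_envelope_def by (subst finite_at_prox) simp

text \<open>This is the first-order optimality condition: compare the minimal value with that at
  \<open>prox x + t (z - prox x)\<close>, bounded by convexity, divide by \<open>t\<close> and let \<open>t\<close> tend to \<open>0\<close>.\<close>

lemma prox_subgradient:
  assumes gz: "g z = ereal s"
  shows "real_of_ereal (g (prox \<gamma> g x)) + (x - prox \<gamma> g x) \<bullet> (z - prox \<gamma> g x) / \<gamma> \<le> s"
proof -
  define p where "p = prox \<gamma> g x"
  define r where "r = real_of_ereal (g p)"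
  define k where "k = 1 / (2 * \<gamma>)"
  define \<Delta> where "\<Delta> = s - r - 2 * k * ((x - p) \<bullet> (z - p))"
  define \<eta> where "\<eta> = k * (norm (z - p))\<^sup>2"
  have gp: "g p = ereal r"
    using finite_at_prox by (simp add: p_def r_def)
  have "\<Delta> + t * \<eta> \<ge> 0" if t: "0 < t" "t < 1" for t
  proof -
    define y where "y = p + t *\<^sub>R (z - p)"
    have "(1 - t) *\<^sub>R (p, r) + t *\<^sub>R (z, s) \<in> ereal_epigraph g"
      using convex_g t gp gz
      by (intro convexD) (auto simp: convex_ereal_def ereal_epigraph_def)
    moreover have "(1 - t) *\<^sub>R (p, r) + t *\<^sub>R (z, s) = (y, (1 - t) * r + t * s)"
      by (simp add: y_def algebra_simps)
    ultimately have gy: "g y \<le> ereal ((1 - t) * r + t * s)"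
      by (simp add: ereal_epigraph_def)
    have "ereal (r + k * (norm (x - p))\<^sup>2)
        \<le> g y + ereal (k * (norm (x - y))\<^sup>2)"
      using prox_minimizes[of x y] gp by (simp add: p_def k_def)
    also have "\<dots> \<le> ereal ((1 - t) * r + t * s) + ereal (k * (norm (x - y))\<^sup>2)"
      by (rule add_right_mono[OF gy])
    finally have le: "r + k * (norm (x - p))\<^sup>2
        \<le> (1 - t) * r + t * s + k * (norm (x - y))\<^sup>2"
      by simp
    have expand: "(norm (x - y))\<^sup>2
        = (norm (x - p))\<^sup>2 - 2 * t * ((x - p) \<bullet> (z - p)) + t\<^sup>2 * (norm (z - p))\<^sup>2"
      unfolding power2_norm_eq_inner y_def
      by (simp add: algebra_simps inner_commute power2_eq_square)
    have "0 \<le> t * (\<Delta> + t * \<eta>)"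
      using le unfolding expand by (simp add: \<Delta>_def \<eta>_def algebra_simps power2_eq_square)
    then show ?thesis
      using t by (simp add: zero_le_mult_iff)
  qed
  then have "eventually (\<lambda>t. \<Delta> + t * \<eta> \<ge> 0) (at_right 0)"
    by (intro eventually_at_rightI[of 0 1]) auto
  moreover have "((\<lambda>t. \<Delta> + t * \<eta>) \<longlongrightarrow> \<Delta> + 0 * \<eta>) (at_right 0)"
    by (intro tendsto_intros)
  ultimately have "\<Delta> + 0 * \<eta> \<ge> 0"
    by (intro tendsto_lowerbound) auto
  then show ?thesis
    by (simp add: \<Delta>_def p_def r_def k_def)
qed

text \<open>Subgradients are monotone: add the subgradient inequalities at \<open>prox x\<close> and \<open>prox y\<close>.\<close>

lemma prox_residual_cocoercive:
  defines "R \<equiv> \<lambda>x. x - prox \<gamma> g x"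
  shows "(norm (R x - R y))\<^sup>2 \<le> (R x - R y) \<bullet> (x - y)"
proof -
  have "(R x) \<bullet> (prox \<gamma> g y - prox \<gamma> g x) + (R y) \<bullet> (prox \<gamma> g x - prox \<gamma> g y) \<le> 0"
    using prox_subgradient[of "prox \<gamma> g y" _ x, OF finite_at_prox]
      prox_subgradient[of "prox \<gamma> g x" _ y, OF finite_at_prox] \<gamma>_pos
    by (simp add: R_def field_simps)
  then show ?thesis
    unfolding power2_norm_eq_inner R_def by (simp add: algebra_simps inner_commute)
qed

text \<open>The envelope is squeezed between its candidate tangent \<open>T\<close> at \<open>x\<close> and \<open>T + \<parallel>\<cdot> - x\<parallel>\<^sup>2 / (2 \<gamma>)\<close>:
  the upper bound tests the minimum at \<open>y\<close> with \<open>prox x\<close>, the lower one applies the subgradient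
  inequality at \<open>prox x\<close> to \<open>prox y\<close>.\<close>

lemma moreau_envelope_tangent:
  defines "v \<equiv> \<lambda>x. (1 / \<gamma>) *\<^sub>R (x - prox \<gamma> g x)"
  shows "\<bar>moreau_envelope \<gamma> g y - moreau_envelope \<gamma> g x - (y - x) \<bullet> v x\<bar>
           \<le> 1 / (2 * \<gamma>) * (norm (y - x))\<^sup>2"
proof -
  define p q r s where "p = prox \<gamma> g x" and "q = prox \<gamma> g y"
    and "r = real_of_ereal (g p)" and "s = real_of_ereal (g q)"
  have gp: "g p = ereal r" and gq: "g q = ereal s"
    using finite_at_prox by (simp_all add: p_def q_def r_def s_def)
  have Mx: "moreau_envelope \<gamma> g x = r + 1 / (2 * \<gamma>) * (norm (x - p))\<^sup>2"
    and My: "moreau_envelope \<gamma> g y = s + 1 / (2 * \<gamma>) * (norm (y - q))\<^sup>2"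
    by (simp_all add: moreau_envelope_eq p_def q_def r_def s_def)
  have vx: "(y - x) \<bullet> v x = 1 / (2 * \<gamma>) * (2 * ((y - x) \<bullet> (x - p)))"
    using \<gamma>_pos by (simp add: v_def p_def)
  have "s + 1 / (2 * \<gamma>) * (norm (y - q))\<^sup>2 \<le> r + 1 / (2 * \<gamma>) * (norm (y - p))\<^sup>2"
    using prox_minimizes[of y p] gp gq by (simp add: q_def)
  moreover have "(norm (y - p))\<^sup>2
      = (norm (x - p))\<^sup>2 + 2 * ((y - x) \<bullet> (x - p)) + (norm (y - x))\<^sup>2"
    unfolding power2_norm_eq_inner by (simp add: algebra_simps inner_commute)
  ultimately have upper: "moreau_envelope \<gamma> g y - moreau_envelope \<gamma> g x - (y - x) \<bullet> v x
      \<le> 1 / (2 * \<gamma>) * (norm (y - x))\<^sup>2"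
    unfolding Mx My vx by (simp add: algebra_simps)
  have "r + 1 / (2 * \<gamma>) * (2 * ((x - p) \<bullet> (q - p))) \<le> s"
    using prox_subgradient[OF gq, of x] \<gamma>_pos by (simp add: p_def r_def)
  moreover have "2 * ((x - p) \<bullet> (q - p)) + (norm (y - q))\<^sup>2
      = (norm (x - p))\<^sup>2 + 2 * ((y - x) \<bullet> (x - p)) + (norm ((y - q) - (x - p)))\<^sup>2"
    unfolding power2_norm_eq_inner by (simp add: algebra_simps inner_commute)
  then have "1 / (2 * \<gamma>) * (2 * ((x - p) \<bullet> (q - p)) + (norm (y - q))\<^sup>2)
      \<ge> 1 / (2 * \<gamma>) * ((norm (x - p))\<^sup>2 + 2 * ((y - x) \<bullet> (x - p)))"
    using \<gamma>_pos by (intro mult_left_mono) auto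
  ultimately have lower: "0 \<le> moreau_envelope \<gamma> g y - moreau_envelope \<gamma> g x - (y - x) \<bullet> v x"
    unfolding Mx My vx by (simp add: algebra_simps)
  show ?thesis
    using lower upper by simp
qed

lemma gradient_moreau_envelope:
  "gradient (moreau_envelope \<gamma> g) x = (1 / \<gamma>) *\<^sub>R (x - prox \<gamma> g x)"
proof (rule gradient_eqI, unfold gderiv_def,
    rule has_derivativeI_sandwich[where e = 1 and H = "\<lambda>y. 1 / (2 * \<gamma>) * norm (y - x)"])
  fix y assume "y \<noteq> x"
  then show "norm (moreau_envelope \<gamma> g y - moreau_envelope \<gamma> g x
        - (y - x) \<bullet> (1 / \<gamma>) *\<^sub>R (x - prox \<gamma> g x)) / norm (y - x) \<le> 1 / (2 * \<gamma>) * norm (y - x)"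
    using moreau_envelope_tangent[of y x] \<gamma>_pos
    by (simp add: field_simps power2_eq_square)
next
  have "((\<lambda>y. 1 / (2 * \<gamma>) * norm (y - x)) \<longlongrightarrow> 1 / (2 * \<gamma>) * norm (x - x)) (at x)"
    by (intro tendsto_intros)
  then show "((\<lambda>y. 1 / (2 * \<gamma>) * norm (y - x)) \<longlongrightarrow> 0) (at x)"
    by simp
qed (simp_all only: zero_less_one bounded_linear_inner_left)

lemma gradient_moreau_envelope_cocoercive:
  defines "v \<equiv> gradient (moreau_envelope \<gamma> g)"
  shows "\<gamma> * (norm (v x - v y))\<^sup>2 \<le> (v x - v y) \<bullet> (x - y)"
proof -
  define w where "w = (x - prox \<gamma> g x) - (y - prox \<gamma> g y)"
  have vw: "v x - v y = (1 / \<gamma>) *\<^sub>R w"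
    unfolding v_def gradient_moreau_envelope w_def by (simp add: scaleR_diff_right)
  have "(norm w)\<^sup>2 / \<gamma> \<le> w \<bullet> (x - y) / \<gamma>"
    using prox_residual_cocoercive[of x y] \<gamma>_pos
    by (intro divide_right_mono) (auto simp: w_def)
  then show ?thesis
    unfolding vw using \<gamma>_pos by (simp add: power_divide power2_eq_square)
qed

end


section \<open>The dissipation inequality\<close>

text \<open>The operator \<open>w \<mapsto> ((v \<bullet> w) / (v \<bullet> u)) v\<close> of rank one will do. It replaces the Hessian of the
  Moreau envelope, averaged over the segment between two states: the envelope is in general only
  once differentiable.\<close>

lemma cocoercive_pair_symmetric_operator:
  fixes u v :: "'b::real_inner"
  assumes "\<gamma> * (norm v)\<^sup>2 \<le> v \<bullet> u" and "\<gamma> > 0"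
  obtains G where "linear G" "G u = v" "\<And>w z. G w \<bullet> z = w \<bullet> G z"
    "\<And>w. \<gamma> * (norm (G w))\<^sup>2 \<le> G w \<bullet> w"
proof (cases "v = 0")
  case True
  then show ?thesis
    using that[of "\<lambda>w. 0"] by (simp add: linear_zero)
next
  case False
  then have pos: "v \<bullet> u > 0"
    using assms by (smt (verit) mult_pos_pos zero_less_norm_iff zero_less_power)
  define G where "G = (\<lambda>w. ((v \<bullet> w) / (v \<bullet> u)) *\<^sub>R v)"
  have "linear G"
    unfolding G_def by (intro linearI) (simp_all add: inner_add_right add_divide_distrib algebra_simps)
  moreover have "G u = v"
    using pos by (simp add: G_def)
  moreover have "G w \<bullet> z = w \<bullet> G z" for w z
    by (simp add: G_def inner_commute)
  moreover have "\<gamma> * (norm (G w))\<^sup>2 \<le> G w \<bullet> w" for w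
  proof -
    have "\<gamma> * (norm (G w))\<^sup>2 = ((v \<bullet> w) / (v \<bullet> u))\<^sup>2 * (\<gamma> * (norm v)\<^sup>2)"
      by (simp add: G_def power_mult_distrib power_divide)
    also have "\<dots> \<le> ((v \<bullet> w) / (v \<bullet> u))\<^sup>2 * (v \<bullet> u)"
      using assms(1) by (rule mult_left_mono) simp
    also have "\<dots> = G w \<bullet> w"
      using pos by (simp add: G_def power2_eq_square)
    finally show ?thesis .
  qed
  ultimately show ?thesis
    by (rule that)
qed

lemma cocoercive_norm_le:
  fixes w z :: "'b::real_inner"
  assumes "\<gamma> * (norm z)\<^sup>2 \<le> z \<bullet> w" "\<gamma> > 0"
  shows "norm z \<le> norm w / \<gamma>"
proof (cases "z = 0")
  case False
  have "\<gamma> * (norm z)\<^sup>2 \<le> norm z * norm w"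
    using assms(1) norm_cauchy_schwarz[of z w] by linarith
  then have "norm z * (\<gamma> * norm z) \<le> norm z * norm w"
    by (simp add: power2_eq_square algebra_simps)
  then have "\<gamma> * norm z \<le> norm w"
    using False by simp
  then show ?thesis
    using assms(2) by (simp add: field_simps)
qed (use assms in simp)

text \<open>Positive semidefiniteness of a \<open>2 \<times> 2\<close> matrix from its Schur complement.\<close>

lemma schur_complement_nonneg:
  fixes a b m s t :: real
  assumes "m\<^sup>2 \<le> a * b" "b > 0"
  shows "2 * m * s * t \<le> a * s\<^sup>2 + b * t\<^sup>2"
proof -
  have "b * (a * s\<^sup>2 + b * t\<^sup>2 - 2 * m * s * t) = (a * b - m\<^sup>2) * s\<^sup>2 + (b * t - m * s)\<^sup>2"
    by (simp add: power2_eq_square algebra_simps)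
  also have "\<dots> \<ge> 0"
    using assms by simp
  finally show ?thesis
    using assms(2) by (simp add: zero_le_mult_iff)
qed

text \<open>The curvature of the dual block. Where the envelope is flat the term \<open>-\<gamma> \<lambda>\<close> damps \<open>\<lambda>\<close>, and
  where it is not the off-diagonal part \<open>\<alpha> A\<close> of the metric transfers damping through
  \<open>A A\<^sup>T\<close>. Here \<open>T\<close> stands for \<open>A\<close>, \<open>T'\<close> for \<open>A\<^sup>T\<close> and \<open>z\<close> for \<open>G y\<close>. With \<open>r = y - \<gamma> z\<close> the right-hand
  side is at least \<open>2 \<alpha> \<parallel>T' y\<parallel>\<^sup>2 - 2 \<alpha> (r \<bullet> T T' y) + 2 \<gamma> \<parallel>r\<parallel>\<^sup>2\<close>. Completing the square in \<open>r\<close> costs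
  \<open>\<alpha>\<^sup>2 / (2 \<gamma>) \<parallel>T T' y\<parallel>\<^sup>2\<close>, which is at most a quarter of \<open>2 \<alpha> \<parallel>T' y\<parallel>\<^sup>2\<close> as \<open>\<alpha> amax \<le> \<gamma>\<close>.\<close>

lemma dual_block_lower_bound:
  fixes T :: "'a::real_inner \<Rightarrow> 'b::real_inner" and y z :: 'b
  assumes adj: "\<And>x y. T x \<bullet> y = x \<bullet> T' y"
    and upper: "\<And>x. (norm (T x))\<^sup>2 \<le> amax * (norm x)\<^sup>2"
    and z: "\<gamma> * (norm z)\<^sup>2 \<le> z \<bullet> y" and "\<gamma> > 0" and "\<alpha> \<ge> 0" and "\<alpha> * amax \<le> \<gamma>"
  shows "3 / 2 * \<alpha> * (norm (T' y))\<^sup>2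
           \<le> 2 * \<alpha> * \<gamma> * (z \<bullet> T (T' y)) + 2 * \<gamma> * (y \<bullet> (y - \<gamma> *\<^sub>R z))"
proof -
  define r where "r = y - \<gamma> *\<^sub>R z"
  define s where "s = T (T' y)"
  have ys: "y \<bullet> s = (norm (T' y))\<^sup>2"
    using adj[of "T' y" y] by (simp add: s_def power2_norm_eq_inner inner_commute)
  have "r \<bullet> r \<le> y \<bullet> r"
  proof -
    have "y \<bullet> r - r \<bullet> r = \<gamma> * (z \<bullet> y - \<gamma> * (norm z)\<^sup>2)"
      unfolding power2_norm_eq_inner r_def by (simp add: algebra_simps inner_commute)
    moreover have "\<dots> \<ge> 0"
      using z \<open>\<gamma> > 0\<close> by simp
    ultimately show ?thesis by linarith
  qed
  then have "2 * \<gamma> * (r \<bullet> r) \<le> 2 * \<gamma> * (y \<bullet> r)"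
    using \<open>\<gamma> > 0\<close> by simp
  moreover have "2 * \<alpha> * (r \<bullet> s) \<le> 2 * \<gamma> * (r \<bullet> r) + \<alpha>\<^sup>2 / (2 * \<gamma>) * (s \<bullet> s)"
  proof -
    have "0 \<le> (norm ((2 * \<gamma>) *\<^sub>R r - \<alpha> *\<^sub>R s))\<^sup>2 / (2 * \<gamma>)"
      using \<open>\<gamma> > 0\<close> by simp
    also have "\<dots> = 2 * \<gamma> * (r \<bullet> r) - 2 * \<alpha> * (r \<bullet> s) + \<alpha>\<^sup>2 / (2 * \<gamma>) * (s \<bullet> s)"
      unfolding power2_norm_eq_inner using \<open>\<gamma> > 0\<close>
      by (simp add: inner_diff_left inner_diff_right inner_commute field_simps power2_eq_square)
    finally show ?thesis by simp
  qed
  moreover have "\<alpha>\<^sup>2 / (2 * \<gamma>) * (s \<bullet> s) \<le> \<alpha> / 2 * (norm (T' y))\<^sup>2"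
  proof -
    have "\<alpha>\<^sup>2 / (2 * \<gamma>) * (s \<bullet> s) \<le> \<alpha>\<^sup>2 / (2 * \<gamma>) * (amax * (norm (T' y))\<^sup>2)"
      using upper[of "T' y"] \<open>\<gamma> > 0\<close>
      by (intro mult_left_mono) (auto simp: s_def power2_norm_eq_inner)
    also have "\<dots> = (\<alpha> * amax) * (\<alpha> / (2 * \<gamma>) * (norm (T' y))\<^sup>2)"
      by (simp add: power2_eq_square)
    also have "\<dots> \<le> \<gamma> * (\<alpha> / (2 * \<gamma>) * (norm (T' y))\<^sup>2)"
      using \<open>\<gamma> > 0\<close> \<open>\<alpha> \<ge> 0\<close> \<open>\<alpha> * amax \<le> \<gamma>\<close> by (intro mult_right_mono) auto
    also have "\<dots> = \<alpha> / 2 * (norm (T' y))\<^sup>2"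
      using \<open>\<gamma> > 0\<close> by simp
    finally show ?thesis .
  qed
  moreover have "\<gamma> * (z \<bullet> s) = (norm (T' y))\<^sup>2 - r \<bullet> s"
    unfolding ys[symmetric] r_def by (simp add: inner_diff_left)
  then have "2 * \<alpha> * (\<gamma> * (z \<bullet> s)) = 2 * \<alpha> * ((norm (T' y))\<^sup>2 - r \<bullet> s)"
    by simp
  ultimately show ?thesis
    unfolding r_def[symmetric] s_def[symmetric] by (simp add: algebra_simps)
qed

text \<open>The coefficient in the last constraint of the nonlinear program dominates the square of the
  norm bound for the off-diagonal block, because \<open>amax / amin \<ge> 1\<close>.\<close>

lemma nlp_feasible_schur:
  assumes feas: "nlp_feasible \<rho> L amin amax \<gamma> \<epsilon> (c, \<alpha>, \<kappa>)"
    and pos: "amin > 0" "amin \<le> amax" "\<gamma> > 0" "L \<ge> 0"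
  defines "K \<equiv> \<gamma> + L + amax / \<gamma> + 2 * c"
    and "a \<equiv> 2 * \<rho> - ReLU (2 * \<alpha> - 2 / \<gamma>) * amax - 2 * c" and "b \<equiv> \<alpha> * amin / \<kappa>"
  shows "(\<alpha> * sqrt amax * K)\<^sup>2 \<le> a * b"
proof -
  have bounds: "c \<ge> 0" "\<alpha> \<ge> 0" "\<kappa> \<ge> 2 / 3"
    and h: "nlp_h \<rho> L amin amax \<gamma> c \<alpha> \<kappa> \<ge> 0"
    using feas by (auto simp: nlp_feasible_def)
  define q where "q = amax / amin"
  define l where "l = L + amax / \<gamma> + 2 * c"
  have "q \<ge> 1"
    using pos by (simp add: q_def)
  have "l \<ge> 0"
    using pos bounds by (simp add: l_def)
  have "K\<^sup>2 = \<gamma>\<^sup>2 * 1 + l\<^sup>2 + 2 * \<gamma> * 1 * l"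
    by (simp add: K_def l_def power2_eq_square algebra_simps)
  also have "\<dots> \<le> \<gamma>\<^sup>2 * q + l\<^sup>2 + 2 * \<gamma> * q * l"
    using \<open>q \<ge> 1\<close> \<open>l \<ge> 0\<close> pos by (intro add_mono mult_right_mono mult_left_mono) auto
  finally have "\<alpha> * \<kappa> * q * K\<^sup>2 \<le> \<alpha> * \<kappa> * q * (\<gamma>\<^sup>2 * q + l\<^sup>2 + 2 * \<gamma> * q * l)"
    using bounds \<open>q \<ge> 1\<close> by (intro mult_left_mono) auto
  also have "\<dots> \<le> a"
    using h by (simp add: nlp_h_def a_def q_def l_def)
  finally have "\<alpha> * \<kappa> * q * K\<^sup>2 * b \<le> a * b"
    using pos bounds by (intro mult_right_mono) (auto simp: b_def)
  moreover have "\<alpha> * \<kappa> * q * K\<^sup>2 * b = (\<alpha> * sqrt amax * K)\<^sup>2"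
    using pos bounds by (simp add: b_def q_def power_mult_distrib) (simp add: power2_eq_square)
  ultimately show ?thesis by simp
qed

text \<open>The contraction inequality for one pair of trajectories, with \<open>x\<close>, \<open>y\<close> the differences of the
  states and \<open>p\<close>, \<open>v\<close> those of the gradients of \<open>f\<close> and of the envelope. Writing
  \<open>v = G (T x + \<gamma> y)\<close> splits the claim into blocks in \<open>x\<close> and \<open>y\<close>. Each of the two equations
  contributes a term \<open>\<gamma> (G y \<bullet> T x)\<close> to the off-diagonal block, with opposite signs; these cancel, and
  all that is left there carries a factor \<open>\<alpha>\<close>. So \<open>\<alpha>\<^sup>2\<close> has to be dominated by the product of a dual
  block of order \<open>\<alpha>\<close> and a primal block of order \<open>1\<close>, which small \<open>\<alpha>\<close> achieves.\<close>

lemma primal_dual_dissipation: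
  fixes T :: "'a::real_inner \<Rightarrow> 'b::real_inner" and T' :: "'b \<Rightarrow> 'a" and x p :: 'a and y v :: 'b
  assumes lin: "linear T" and adj: "\<And>x y. T x \<bullet> y = x \<bullet> T' y"
    and lower: "\<And>y. amin * (norm y)\<^sup>2 \<le> (norm (T' y))\<^sup>2"
    and upper: "\<And>y. norm (T' y) \<le> sqrt amax * norm y"
    and upper': "\<And>x. norm (T x) \<le> sqrt amax * norm x"
    and p: "\<rho> * (norm x)\<^sup>2 \<le> p \<bullet> x" "norm p \<le> L * norm x"
    and v: "\<gamma> * (norm v)\<^sup>2 \<le> v \<bullet> (T x + \<gamma> *\<^sub>R y)"
    and pos: "amin > 0" "amin \<le> amax" "\<gamma> > 0" "L \<ge> 0"
    and feas: "nlp_feasible \<rho> L amin amax \<gamma> \<epsilon> (c, \<alpha>, \<kappa>)" and "\<alpha> > 0"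
  shows "(- p - T' v) \<bullet> (x + \<alpha> *\<^sub>R T' y) + \<gamma> * ((v - y) \<bullet> (\<alpha> *\<^sub>R T x + y))
           \<le> - c * ((norm x)\<^sup>2 + 2 * \<alpha> * (T x \<bullet> y) + (norm y)\<^sup>2)"
proof -
  have "amax > 0" using pos by simp
  have bounds: "c \<ge> 0" "\<kappa> \<ge> 2 / 3" "\<alpha> \<le> \<gamma> / amax" "c \<le> (3 / 4 - 1 / (2 * \<kappa>)) * \<alpha> * amin"
    using feas by (auto simp: nlp_feasible_def)
  define K where "K = \<gamma> + L + amax / \<gamma> + 2 * c"
  define a where "a = 2 * \<rho> - ReLU (2 * \<alpha> - 2 / \<gamma>) * amax - 2 * c"
  define b where "b = \<alpha> * amin / \<kappa>"
  obtain G where G: "linear G" "G (T x + \<gamma> *\<^sub>R y) = v" "\<And>w z. G w \<bullet> z = w \<bullet> G z"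
      and coco: "\<And>w. \<gamma> * (norm (G w))\<^sup>2 \<le> G w \<bullet> w"
    using cocoercive_pair_symmetric_operator[OF v \<open>\<gamma> > 0\<close>] by blast
  define \<xi> where "\<xi> = T x"
  define s where "s = T (T' y)"
  define r where "r = y - \<gamma> *\<^sub>R G y"
  have v_eq: "v = G \<xi> + \<gamma> *\<^sub>R G y"
    using G(1,2) by (simp add: \<xi>_def linear_add linear_cmul)
  have G\<xi>: "norm (G \<xi>) \<le> norm \<xi> / \<gamma>"
    using cocoercive_norm_le[OF coco \<open>\<gamma> > 0\<close>] .
  have \<xi>: "norm \<xi> \<le> sqrt amax * norm x"
    using upper' by (simp add: \<xi>_def)
  have s: "norm s \<le> amax * norm y"
  proof -
    have "norm s \<le> sqrt amax * (sqrt amax * norm y)"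
      unfolding s_def using \<open>amax > 0\<close>
      by (intro order_trans[OF upper'[of "T' y"]] mult_left_mono upper) simp
    then show ?thesis
      using \<open>amax > 0\<close> by (simp add: mult.assoc[symmetric])
  qed

  have primal: "a * (norm x)\<^sup>2 \<le> 2 * (p \<bullet> x) + (2 - 2 * \<alpha> * \<gamma>) * (G \<xi> \<bullet> \<xi>) - 2 * c * (norm x)\<^sup>2"
  proof -
    have "0 \<le> \<gamma> * (norm (G \<xi>))\<^sup>2"
      using \<open>\<gamma> > 0\<close> by simp
    also have "\<dots> \<le> G \<xi> \<bullet> \<xi>"
      by (rule coco)
    finally have nonneg: "0 \<le> G \<xi> \<bullet> \<xi>" .
    have "G \<xi> \<bullet> \<xi> \<le> norm (G \<xi>) * norm \<xi>"
      by (rule norm_cauchy_schwarz)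
    also have "\<dots> \<le> (norm \<xi> / \<gamma>) * norm \<xi>"
      using G\<xi> by (rule mult_right_mono) simp
    finally have "\<gamma> * (G \<xi> \<bullet> \<xi>) \<le> (norm \<xi>)\<^sup>2"
      using \<open>\<gamma> > 0\<close> by (simp add: field_simps power2_eq_square)
    also have "\<dots> \<le> amax * (norm x)\<^sup>2"
      using power_mono[OF \<xi>, of 2] \<open>amax > 0\<close> by (simp add: power_mult_distrib)
    finally have le: "\<gamma> * (G \<xi> \<bullet> \<xi>) \<le> amax * (norm x)\<^sup>2" .
    define R where "R = ReLU (2 * \<alpha> - 2 / \<gamma>)"
    have R: "R \<ge> 0" "2 * \<alpha> - 2 / \<gamma> \<le> R"
      by (auto simp: R_def ReLU_def)
    have "(2 * \<alpha> * \<gamma> - 2) * (G \<xi> \<bullet> \<xi>) = (2 * \<alpha> - 2 / \<gamma>) * (\<gamma> * (G \<xi> \<bullet> \<xi>))"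
      using \<open>\<gamma> > 0\<close> by (simp add: algebra_simps)
    also have "\<dots> \<le> R * (\<gamma> * (G \<xi> \<bullet> \<xi>))"
      using R nonneg \<open>\<gamma> > 0\<close> by (intro mult_right_mono) auto
    also have "\<dots> \<le> R * (amax * (norm x)\<^sup>2)"
      using le R by (intro mult_left_mono) auto
    finally show ?thesis
      using p(1) by (simp add: a_def R_def algebra_simps)
  qed

  have dual: "b * (norm y)\<^sup>2
      \<le> 2 * \<alpha> * \<gamma> * (G y \<bullet> s) + 2 * \<gamma> * (y \<bullet> r) - 2 * c * (norm y)\<^sup>2"
  proof -
    have "(norm (T w))\<^sup>2 \<le> amax * (norm w)\<^sup>2" for w
      using power_mono[OF upper'[of w], of 2] \<open>amax > 0\<close> by (simp add: power_mult_distrib)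
    then have "3 / 2 * \<alpha> * (norm (T' y))\<^sup>2 \<le> 2 * \<alpha> * \<gamma> * (G y \<bullet> s) + 2 * \<gamma> * (y \<bullet> r)"
      unfolding r_def s_def using coco[of y] pos \<open>\<alpha> > 0\<close> bounds(3) \<open>amax > 0\<close>
      by (intro dual_block_lower_bound adj) (auto simp: field_simps)
    moreover have "3 / 2 * \<alpha> * (amin * (norm y)\<^sup>2) \<le> 3 / 2 * \<alpha> * (norm (T' y))\<^sup>2"
      using lower[of y] \<open>\<alpha> > 0\<close> by (intro mult_left_mono) auto
    moreover have "(b + 2 * c) * (norm y)\<^sup>2 \<le> 3 / 2 * \<alpha> * amin * (norm y)\<^sup>2"
      using bounds by (intro mult_right_mono) (auto simp: b_def algebra_simps)
    ultimately show ?thesis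
      by (simp add: algebra_simps)
  qed

  have cross: "\<bar>p \<bullet> T' y + G \<xi> \<bullet> s + \<gamma> * (r \<bullet> \<xi>) - 2 * c * (\<xi> \<bullet> y)\<bar>
      \<le> sqrt amax * K * norm x * norm y"
  proof -
    have "(norm r)\<^sup>2 = (norm y)\<^sup>2 - \<gamma> * (2 * (G y \<bullet> y) - \<gamma> * (norm (G y))\<^sup>2)"
      unfolding r_def power2_norm_eq_inner
      by (simp add: algebra_simps inner_commute power2_eq_square)
    moreover have "0 \<le> \<gamma> * (norm (G y))\<^sup>2"
      using \<open>\<gamma> > 0\<close> by simp
    then have "2 * (G y \<bullet> y) - \<gamma> * (norm (G y))\<^sup>2 \<ge> 0"
      using coco[of y] by linarith
    ultimately have "(norm r)\<^sup>2 \<le> (norm y)\<^sup>2"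
      using \<open>\<gamma> > 0\<close> by simp
    then have r: "norm r \<le> norm y"
      by (simp add: power2_le_iff_abs_le)
    have 1: "\<bar>p \<bullet> T' y\<bar> \<le> (L * norm x) * (sqrt amax * norm y)"
      using Cauchy_Schwarz_ineq2[of p "T' y"] mult_mono[OF p(2) upper[of y]] pos by force
    have "norm (G \<xi>) \<le> sqrt amax * norm x / \<gamma>"
      using G\<xi> divide_right_mono[OF \<xi>, of \<gamma>] \<open>\<gamma> > 0\<close> by linarith
    then have "norm (G \<xi>) * norm s \<le> (sqrt amax * norm x / \<gamma>) * (amax * norm y)"
      using s pos \<open>amax > 0\<close> by (intro mult_mono) auto
    then have 2: "\<bar>G \<xi> \<bullet> s\<bar> \<le> (sqrt amax * norm x / \<gamma>) * (amax * norm y)"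
      using Cauchy_Schwarz_ineq2[of "G \<xi>" s] by linarith
    have "norm r * norm \<xi> \<le> norm y * (sqrt amax * norm x)"
      using r \<xi> by (intro mult_mono) auto
    then have "\<bar>r \<bullet> \<xi>\<bar> \<le> norm y * (sqrt amax * norm x)"
      using Cauchy_Schwarz_ineq2[of r \<xi>] by linarith
    then have 3: "\<bar>\<gamma> * (r \<bullet> \<xi>)\<bar> \<le> \<gamma> * (norm y * (sqrt amax * norm x))"
      using \<open>\<gamma> > 0\<close> by (simp add: abs_mult)
    have "norm \<xi> * norm y \<le> (sqrt amax * norm x) * norm y"
      using \<xi> by (intro mult_right_mono) auto
    then have "\<bar>\<xi> \<bullet> y\<bar> \<le> (sqrt amax * norm x) * norm y"
      using Cauchy_Schwarz_ineq2[of \<xi> y] by linarith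
    then have 4: "\<bar>2 * c * (\<xi> \<bullet> y)\<bar> \<le> 2 * c * ((sqrt amax * norm x) * norm y)"
      using bounds(1) by (simp add: abs_mult mult_left_mono)
    have "sqrt amax * K * norm x * norm y
        = (L * norm x) * (sqrt amax * norm y) + (sqrt amax * norm x / \<gamma>) * (amax * norm y)
          + \<gamma> * (norm y * (sqrt amax * norm x)) + 2 * c * ((sqrt amax * norm x) * norm y)"
      by (simp add: K_def algebra_simps)
    then show ?thesis
      using 1 2 3 4 by linarith
  qed

  have "2 * (\<alpha> * sqrt amax * K) * norm x * norm y \<le> a * (norm x)\<^sup>2 + b * (norm y)\<^sup>2"
  proof (rule schur_complement_nonneg)
    show "(\<alpha> * sqrt amax * K)\<^sup>2 \<le> a * b"
      unfolding K_def a_def b_def by (rule nlp_feasible_schur[OF feas pos])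
    show "b > 0"
      using \<open>\<alpha> > 0\<close> pos bounds by (simp add: b_def)
  qed
  moreover have "- (2 * \<alpha>) * (p \<bullet> T' y + G \<xi> \<bullet> s + \<gamma> * (r \<bullet> \<xi>) - 2 * c * (\<xi> \<bullet> y))
      \<le> 2 * (\<alpha> * sqrt amax * K) * norm x * norm y"
  proof -
    have "(2 * \<alpha>) * - (p \<bullet> T' y + G \<xi> \<bullet> s + \<gamma> * (r \<bullet> \<xi>) - 2 * c * (\<xi> \<bullet> y))
        \<le> (2 * \<alpha>) * (sqrt amax * K * norm x * norm y)"
      using cross \<open>\<alpha> > 0\<close> by (intro mult_left_mono) auto
    then show ?thesis
      by (simp add: algebra_simps)
  qed
  ultimately have nonneg: "0 \<le> (2 * (p \<bullet> x) + (2 - 2 * \<alpha> * \<gamma>) * (G \<xi> \<bullet> \<xi>) - 2 * c * (norm x)\<^sup>2)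
      + (2 * \<alpha> * \<gamma> * (G y \<bullet> s) + 2 * \<gamma> * (y \<bullet> r) - 2 * c * (norm y)\<^sup>2)
      + 2 * \<alpha> * (p \<bullet> T' y + G \<xi> \<bullet> s + \<gamma> * (r \<bullet> \<xi>) - 2 * c * (\<xi> \<bullet> y))"
    using primal dual by linarith

  have adj': "T' w \<bullet> z = w \<bullet> T z" for w z
    using adj[of z w] by (simp add: inner_commute)
  have sym: "G \<xi> \<bullet> y = G y \<bullet> \<xi>"
    using G(3)[of \<xi> y] by (simp add: inner_commute)
  have primal_part: "(- p - T' v) \<bullet> (x + \<alpha> *\<^sub>R T' y)
      = - (p \<bullet> x) - \<alpha> * (p \<bullet> T' y) - v \<bullet> \<xi> - \<alpha> * (v \<bullet> s)"
    unfolding \<xi>_def s_def adj'[symmetric] by (simp add: algebra_simps)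
  have dual_part: "\<gamma> * ((v - y) \<bullet> (\<alpha> *\<^sub>R \<xi> + y))
      = \<gamma> * \<alpha> * (v \<bullet> \<xi>) + \<gamma> * (v \<bullet> y) - \<gamma> * \<alpha> * (\<xi> \<bullet> y) - \<gamma> * (norm y)\<^sup>2"
    unfolding power2_norm_eq_inner by (simp add: inner_commute algebra_simps)
  have v_inner: "v \<bullet> \<xi> = G \<xi> \<bullet> \<xi> + \<gamma> * (G y \<bullet> \<xi>)" "v \<bullet> s = G \<xi> \<bullet> s + \<gamma> * (G y \<bullet> s)"
    "v \<bullet> y = G y \<bullet> \<xi> + \<gamma> * (G y \<bullet> y)"
    by (simp_all add: v_eq inner_add_left sym)
  have r_inner: "y \<bullet> r = (norm y)\<^sup>2 - \<gamma> * (G y \<bullet> y)" "r \<bullet> \<xi> = \<xi> \<bullet> y - \<gamma> * (G y \<bullet> \<xi>)"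
    by (simp_all add: r_def power2_norm_eq_inner inner_diff_left inner_diff_right inner_commute)
  show ?thesis
    using nonneg unfolding \<xi>_def[symmetric] primal_part dual_part v_inner r_inner
    by (simp add: algebra_simps)
qed


section \<open>Solvability of the nonlinear program\<close>

text \<open>For \<open>\<kappa> = 1\<close> the bound on \<open>c\<close> is \<open>\<alpha> amin / 4\<close>, and along \<open>c = \<alpha> amin / 4\<close> the function \<open>h\<close> tends
  to \<open>2 \<rho> > 0\<close> as \<open>\<alpha>\<close> tends to \<open>0\<close>.\<close>

lemma nlp_feasible_positive:
  assumes "\<rho> > 0" "amin > 0" "amax > 0" "\<gamma> > 0" "\<epsilon> < 1 / sqrt amax"
  obtains c \<alpha> \<kappa> where "nlp_feasible \<rho> L amin amax \<gamma> \<epsilon> (c, \<alpha>, \<kappa>)" "c > 0"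
proof -
  define h where "h = (\<lambda>\<alpha>. nlp_h \<rho> L amin amax \<gamma> (\<alpha> * amin / 4) \<alpha> 1)"
  have "(h \<longlongrightarrow> h 0) (at_right 0)"
  proof -
    have "continuous_on UNIV h"
      unfolding h_def nlp_h_def ReLU_def by (intro continuous_intros) auto
    then show ?thesis
      using continuous_on_eq_continuous_at[of UNIV h] continuous_within filterlim_at_split
      by (metis UNIV_I open_UNIV)
  qed
  moreover have "h 0 > 0"
    using assms by (simp add: h_def nlp_h_def ReLU_def)
  ultimately have "eventually (\<lambda>\<alpha>. h \<alpha> > 0) (at_right 0)"
    by (rule order_tendstoD)
  moreover have "min (1 / sqrt amax - \<epsilon>) (\<gamma> / amax) > 0"
    using assms by simp
  then have "eventually (\<lambda>\<alpha>. \<alpha> \<in> {0<..<min (1 / sqrt amax - \<epsilon>) (\<gamma> / amax)}) (at_right 0)"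
    by (rule eventually_at_right_real)
  ultimately have "eventually (\<lambda>\<alpha>. h \<alpha> > 0 \<and> \<alpha> \<in> {0<..<min (1 / sqrt amax - \<epsilon>) (\<gamma> / amax)})
      (at_right (0::real))"
    by (rule eventually_conj)
  then obtain \<alpha> where "h \<alpha> > 0" "\<alpha> \<in> {0<..<min (1 / sqrt amax - \<epsilon>) (\<gamma> / amax)}"
    using eventually_happens trivial_limit_at_right_real by blast
  then show ?thesis
    using assms by (intro that[of "\<alpha> * amin / 4" \<alpha> 1]) (auto simp: nlp_feasible_def h_def)
qed

text \<open>A positive lower bound on \<open>c\<close> forces one on \<open>\<alpha>\<close>, and then \<open>h \<ge> 0\<close> bounds \<open>\<kappa>\<close>, the only
  variable that is unbounded over the whole feasible set. So the feasible points that are at least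
  as good as a given one with \<open>c > 0\<close> form a compact set.\<close>

lemma nlp_optimal_exists:
  assumes pos: "\<rho> > 0" "amin > 0" "amax > 0" "\<gamma> > 0" "L \<ge> 0" and "\<epsilon> < 1 / sqrt amax"
  shows "\<exists>c \<alpha> \<kappa>. nlp_optimal \<rho> L amin amax \<gamma> \<epsilon> (c, \<alpha>, \<kappa>)"
proof -
  obtain c0 \<alpha>0 \<kappa>0 where feas0: "nlp_feasible \<rho> L amin amax \<gamma> \<epsilon> (c0, \<alpha>0, \<kappa>0)" and "c0 > 0"
    using nlp_feasible_positive assms by metis
  define M where "M = \<gamma> / amax"
  define \<alpha>' where "\<alpha>' = c0 / (3 / 4 * amin)"
  define D where "D = \<alpha>' * (amax / amin) * (\<gamma>\<^sup>2 * (amax / amin))"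
  have "\<alpha>' > 0" "D > 0"
    using pos \<open>c0 > 0\<close> by (simp_all add: \<alpha>'_def D_def)
  (* Multiplying the bound on c by 2 \<kappa> removes the division, so that all constraints are visibly
     continuous. *)
  define S where "S = {(c, \<alpha>, \<kappa>). c \<ge> c0 \<and> \<alpha> \<ge> 0 \<and> \<kappa> \<ge> 2 / 3
     \<and> \<alpha> \<le> min (1 / sqrt amax - \<epsilon>) (\<gamma> / amax)
     \<and> c * (2 * \<kappa>) \<le> (3 / 2 * \<kappa> - 1) * \<alpha> * amin
     \<and> nlp_h \<rho> L amin amax \<gamma> c \<alpha> \<kappa> \<ge> 0}"
  have S_iff: "(c, \<alpha>, \<kappa>) \<in> S \<longleftrightarrow> nlp_feasible \<rho> L amin amax \<gamma> \<epsilon> (c, \<alpha>, \<kappa>) \<and> c \<ge> c0" for c \<alpha> \<kappa>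
  proof -
    have "c \<le> (3 / 4 - 1 / (2 * \<kappa>)) * \<alpha> * amin \<longleftrightarrow> c * (2 * \<kappa>) \<le> (3 / 2 * \<kappa> - 1) * \<alpha> * amin"
      if "\<kappa> \<ge> 2 / 3"
    proof -
      have scaled: "(3 / 4 - 1 / (2 * \<kappa>)) * \<alpha> * amin * (2 * \<kappa>) = (3 / 2 * \<kappa> - 1) * \<alpha> * amin"
        using that by (simp add: field_simps)
      have "c \<le> (3 / 4 - 1 / (2 * \<kappa>)) * \<alpha> * amin
          \<longleftrightarrow> c * (2 * \<kappa>) \<le> (3 / 4 - 1 / (2 * \<kappa>)) * \<alpha> * amin * (2 * \<kappa>)"
        using that by (intro mult_le_cancel_right_pos[symmetric]) simp
      then show ?thesis
        by (simp only: scaled)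
    qed
    then show ?thesis
      using \<open>c0 > 0\<close> unfolding S_def nlp_feasible_def by auto
  qed
  have "S \<subseteq> {0..M * amin} \<times> {0..M} \<times> {0..2 * \<rho> / D}"
  proof
    fix e assume "e \<in> S"
    then obtain c \<alpha> \<kappa> where e: "e = (c, \<alpha>, \<kappa>)" and feas: "nlp_feasible \<rho> L amin amax \<gamma> \<epsilon> (c, \<alpha>, \<kappa>)"
        and "c \<ge> c0"
      using S_iff by (cases e) auto
    then have b: "c \<ge> 0" "\<alpha> \<ge> 0" "\<alpha> \<le> M" "\<kappa> \<ge> 2 / 3" "c \<le> (3 / 4 - 1 / (2 * \<kappa>)) * \<alpha> * amin"
        and h: "nlp_h \<rho> L amin amax \<gamma> c \<alpha> \<kappa> \<ge> 0"
      by (auto simp: nlp_feasible_def M_def)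
    have c_le: "c \<le> 3 / 4 * \<alpha> * amin"
    proof -
      have "(3 / 4 - 1 / (2 * \<kappa>)) * (\<alpha> * amin) \<le> 3 / 4 * (\<alpha> * amin)"
        using b pos by (intro mult_right_mono) auto
      then show ?thesis using b by simp
    qed
    have "\<alpha> \<ge> \<alpha>'"
      using c_le \<open>c \<ge> c0\<close> pos by (simp add: \<alpha>'_def field_simps)
    have "c \<le> M * amin"
    proof -
      have "3 / 4 * \<alpha> * amin \<le> 1 * M * amin"
        using b pos by (intro mult_right_mono mult_mono) auto
      then show ?thesis using c_le by simp
    qed
    moreover have "\<kappa> \<le> 2 * \<rho> / D"
    proof -
      define l where "l = L + amax / \<gamma> + 2 * c"
      define q where "q = amax / amin"
      have "l \<ge> 0" "q > 0"
        using pos b by (simp_all add: l_def q_def)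
      have "\<kappa> * D = \<alpha>' * \<kappa> * q * (\<gamma>\<^sup>2 * q)"
        by (simp add: D_def q_def)
      also have "\<dots> \<le> \<alpha> * \<kappa> * q * (\<gamma>\<^sup>2 * q + l\<^sup>2 + 2 * \<gamma> * q * l)"
        using \<open>\<alpha> \<ge> \<alpha>'\<close> \<open>\<alpha>' > 0\<close> \<open>l \<ge> 0\<close> \<open>q > 0\<close> b pos by (intro mult_mono) auto
      also have "\<dots> \<le> 2 * \<rho> - ReLU (2 * \<alpha> - 2 / \<gamma>) * amax - 2 * c"
        using h by (simp add: nlp_h_def l_def q_def)
      also have "\<dots> \<le> 2 * \<rho>"
      proof -
        have "ReLU (2 * \<alpha> - 2 / \<gamma>) * amax \<ge> 0"
          using pos by (simp add: ReLU_def)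
        then show ?thesis
          using b by linarith
      qed
      finally show ?thesis
        using \<open>D > 0\<close> by (simp add: field_simps)
    qed
    ultimately show "e \<in> {0..M * amin} \<times> {0..M} \<times> {0..2 * \<rho> / D}"
      using b by (simp add: e)
  qed
  moreover have "closed S"
    unfolding S_def case_prod_beta nlp_h_def ReLU_def
    by (intro closed_Collect_conj closed_Collect_le continuous_intros)
  moreover have "compact ({0..M * amin} \<times> {0..M} \<times> {0..2 * \<rho> / D})"
    by (intro compact_Times) auto
  ultimately have "compact S"
    using compact_Int_closed inf.absorb_iff2 by metis
  moreover have in_S: "(c0, \<alpha>0, \<kappa>0) \<in> S"
    using S_iff feas0 by simp
  moreover have "continuous_on S fst"
    by (intro continuous_intros)
  ultimately obtain e where e: "e \<in> S" "\<And>e'. e' \<in> S \<Longrightarrow> fst e' \<le> fst e"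
    using continuous_attains_sup[of S fst] by blast
  obtain c \<alpha> \<kappa> where e_eq: "e = (c, \<alpha>, \<kappa>)"
    by (cases e)
  have "c' \<le> c" if feas': "nlp_feasible \<rho> L amin amax \<gamma> \<epsilon> (c', \<alpha>', \<kappa>')" for c' \<alpha>' \<kappa>'
  proof (cases "c' \<ge> c0")
    case True
    then show ?thesis
      using e(2)[of "(c', \<alpha>', \<kappa>')"] S_iff feas' by (simp add: e_eq)
  next
    case False
    then show ?thesis
      using e(2)[OF in_S] by (simp add: e_eq)
  qed
  then have "nlp_optimal \<rho> L amin amax \<gamma> \<epsilon> (c, \<alpha>, \<kappa>)"
    using e(1) S_iff unfolding nlp_optimal_def is_arg_max_def e_eq by (auto simp: not_less)
  then show ?thesis
    by blast
qed

lemma nlp_optimal_positive: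
  assumes opt: "nlp_optimal \<rho> L amin amax \<gamma> \<epsilon> (c, \<alpha>, \<kappa>)"
    and pos: "\<rho> > 0" "amin > 0" "amax > 0" "\<gamma> > 0" "\<epsilon> < 1 / sqrt amax"
  shows "c > 0" "\<alpha> > 0"
proof -
  have feas: "nlp_feasible \<rho> L amin amax \<gamma> \<epsilon> (c, \<alpha>, \<kappa>)"
    using opt by (simp add: nlp_optimal_def is_arg_max_def)
  obtain c0 \<alpha>0 \<kappa>0 where "nlp_feasible \<rho> L amin amax \<gamma> \<epsilon> (c0, \<alpha>0, \<kappa>0)" "c0 > 0"
    using nlp_feasible_positive pos by metis
  then show "c > 0"
    using opt unfolding nlp_optimal_def is_arg_max_def by force
  then show "\<alpha> > 0"
    using feas by (cases "\<alpha> = 0") (auto simp: nlp_feasible_def)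
qed


section \<open>Block vectors and matrices\<close>

lemma inner_join_vec:
  fixes x :: "real^'n" and y :: "real^'m"
  shows "join_vec x y \<bullet> z = x \<bullet> left_vec z + y \<bullet> right_vec z"
  unfolding inner_vec_def UNIV_Plus_UNIV[symmetric]
  by (simp add: sum.Plus join_vec_def left_vec_def right_vec_def del: UNIV_Plus_UNIV)

lemma join_vec_nth:
  "join_vec x y $ i = (case i of Inl j \<Rightarrow> x $ j | Inr k \<Rightarrow> y $ k)"
  by (simp add: join_vec_def)

lemma left_join_vec [simp]: "left_vec (join_vec x y) = x"
  by (simp add: left_vec_def join_vec_def vec_eq_iff)

lemma right_join_vec [simp]: "right_vec (join_vec x y) = y"
  by (simp add: right_vec_def join_vec_def vec_eq_iff)

lemma left_vec_diff: "left_vec (z - w :: real^('n::finite + 'm::finite)) = left_vec z - left_vec w"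
  by (simp add: left_vec_def vec_eq_iff)

lemma right_vec_diff: "right_vec (z - w :: real^('n::finite + 'm::finite)) = right_vec z - right_vec w"
  by (simp add: right_vec_def vec_eq_iff)

lemma join_vec_diff:
  "join_vec x y - join_vec x' y' = (join_vec (x - x') (y - y') :: real^('n::finite + 'm::finite))"
  by (simp add: join_vec_def vec_eq_iff split: sum.split)

lemma block_matrix_mult_vec:
  fixes M11 :: "real^'n^'n" and M12 :: "real^'m^'n" and M21 :: "real^'n^'m" and M22 :: "real^'m^'m"
  shows "block_matrix M11 M12 M21 M22 *v z
    = join_vec (M11 *v left_vec z + M12 *v right_vec z) (M21 *v left_vec z + M22 *v right_vec z)"
  by (simp add: vec_eq_iff matrix_mult_dot block_matrix_def inner_join_vec join_vec_nth
      split: sum.split)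

lemma continuous_on_join_vec:
  fixes f :: "'a::topological_space \<Rightarrow> real^'n" and g :: "'a \<Rightarrow> real^'m"
  assumes "continuous_on S f" "continuous_on S g"
  shows "continuous_on S (\<lambda>z. join_vec (f z) (g z))"
  unfolding join_vec_def
proof (rule continuous_on_vec_lambda)
  fix i :: "'n + 'm"
  show "continuous_on S (\<lambda>z. case i of Inl j \<Rightarrow> f z $ j | Inr k \<Rightarrow> g z $ k)"
    using assms by (cases i) (auto intro: continuous_intros)
qed

lemma continuous_on_left_vec: "continuous_on S (left_vec :: real^('n::finite + 'm::finite) \<Rightarrow> _)"
  unfolding left_vec_def by (intro continuous_on_vec_lambda continuous_intros)

lemma continuous_on_right_vec: "continuous_on S (right_vec :: real^('n::finite + 'm::finite) \<Rightarrow> _)"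
  unfolding right_vec_def by (intro continuous_on_vec_lambda continuous_intros)

lemma contraction_metric_mult_vec:
  "contraction_metric A \<alpha> *v z
    = join_vec (left_vec z + \<alpha> *\<^sub>R (transpose A *v right_vec z))
        (\<alpha> *\<^sub>R (A *v left_vec z) + right_vec z)"
  unfolding contraction_metric_def block_matrix_mult_vec
  by (simp only: matrix_vector_mul_lid scaleR_matrix_vector_assoc[symmetric])

lemma inner_matrix_vector_mult_adjoint:
  fixes A :: "real^'n^'m"
  shows "(A *v x) \<bullet> y = x \<bullet> (transpose A *v y)"
  by (metis dot_lmul_matrix inner_commute transpose_matrix_vector)

lemma contraction_metric_quadratic_form:
  "z \<bullet> (contraction_metric A \<alpha> *v z)
    = (norm (left_vec z))\<^sup>2 + 2 * \<alpha> * ((A *v left_vec z) \<bullet> right_vec z) + (norm (right_vec z))\<^sup>2"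
proof -
  have "(transpose A *v right_vec z) \<bullet> left_vec z = (A *v left_vec z) \<bullet> right_vec z"
    by (metis inner_matrix_vector_mult_adjoint inner_commute)
  then have "(contraction_metric A \<alpha> *v z) \<bullet> z
    = (norm (left_vec z))\<^sup>2 + 2 * \<alpha> * ((A *v left_vec z) \<bullet> right_vec z) + (norm (right_vec z))\<^sup>2"
    unfolding contraction_metric_mult_vec inner_join_vec
    by (simp add: inner_add_left power2_norm_eq_inner del: transpose_matrix_vector)
  then show ?thesis
    by (simp only: inner_commute)
qed

lemma transpose_contraction_metric: "transpose (contraction_metric A \<alpha>) = contraction_metric A \<alpha>"
  by (auto simp: contraction_metric_def block_matrix_def join_vec_def transpose_def vec_eq_iff mat_def
      split: sum.split)

text \<open>The bound \<open>\<alpha> < 1 / \<parallel>A\<parallel>\<close> makes the off-diagonal part of the metric a strict perturbation of the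
  identity.\<close>

lemma pos_def_contraction_metric:
  fixes A :: "real^'n^'m"
  assumes upper: "\<And>x. norm (A *v x) \<le> sqrt amax * norm x"
    and "\<alpha> \<ge> 0" "amax \<ge> 0" "\<alpha> * sqrt amax < 1"
  shows "pos_def (contraction_metric A \<alpha>)"
  unfolding pos_def_def
proof (intro conjI allI impI transpose_contraction_metric)
  fix z :: "real^('n + 'm)" assume "z \<noteq> 0"
  define x y where "x = left_vec z" and "y = right_vec z"
  have "x \<noteq> 0 \<or> y \<noteq> 0"
    using \<open>z \<noteq> 0\<close> unfolding x_def y_def left_vec_def right_vec_def
    by (simp add: vec_eq_iff) (metis sum.exhaust)
  then have pos: "(norm x)\<^sup>2 + (norm y)\<^sup>2 > 0"
    by (smt (verit) zero_less_norm_iff zero_less_power zero_le_power2)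
  have "\<bar>(A *v x) \<bullet> y\<bar> \<le> norm (A *v x) * norm y"
    by (rule Cauchy_Schwarz_ineq2)
  also have "\<dots> \<le> sqrt amax * norm x * norm y"
    using upper by (rule mult_right_mono) simp
  finally have "2 * \<alpha> * \<bar>(A *v x) \<bullet> y\<bar> \<le> 2 * \<alpha> * (sqrt amax * norm x * norm y)"
    using \<open>\<alpha> \<ge> 0\<close> by (intro mult_left_mono) auto
  also have "\<dots> = (\<alpha> * sqrt amax) * (2 * norm x * norm y)"
    by simp
  also have "\<dots> \<le> (\<alpha> * sqrt amax) * ((norm x)\<^sup>2 + (norm y)\<^sup>2)"
  proof (rule mult_left_mono)
    show "2 * norm x * norm y \<le> (norm x)\<^sup>2 + (norm y)\<^sup>2"
      by (rule sum_squares_bound)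
    show "\<alpha> * sqrt amax \<ge> 0"
      using \<open>\<alpha> \<ge> 0\<close> \<open>amax \<ge> 0\<close> by simp
  qed
  also have "\<dots> < 1 * ((norm x)\<^sup>2 + (norm y)\<^sup>2)"
    using pos \<open>\<alpha> * sqrt amax < 1\<close> by (rule mult_strict_right_mono[rotated])
  finally have "\<bar>2 * \<alpha> * ((A *v x) \<bullet> y)\<bar> < (norm x)\<^sup>2 + (norm y)\<^sup>2"
    using \<open>\<alpha> \<ge> 0\<close> by (simp add: abs_mult)
  then show "0 < z \<bullet> (contraction_metric A \<alpha> *v z)"
    unfolding contraction_metric_quadratic_form x_def y_def by linarith
qed

lemma loewner_le_inner:
  assumes "X \<preceq> Y"
  shows "x \<bullet> (X *v x) \<le> x \<bullet> (Y *v x)"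
  using assms unfolding loewner_le_def pos_semidef_def
  by (simp add: matrix_vector_mult_diff_rdistrib inner_diff_right)

lemma scaled_identity_inner: "y \<bullet> ((a *\<^sub>R mat 1 :: real^'m^'m) *v y) = a * (norm y)\<^sup>2"
  by (simp add: scaleR_matrix_vector_assoc[symmetric] power2_norm_eq_inner)

lemma gram_inner: "y \<bullet> ((A ** transpose A) *v y) = (norm (transpose A *v (y::real^'m)))\<^sup>2"
  unfolding matrix_vector_mul_assoc[symmetric]
  by (metis inner_commute inner_matrix_vector_mult_adjoint power2_norm_eq_inner)

text \<open>This rests on \<open>\<parallel>A x\<parallel>\<^sup>2 = x \<bullet> A\<^sup>T (A x)\<close> and the Cauchy-Schwarz inequality.\<close>

lemma norm_matrix_vector_mult_le_of_transpose:
  fixes A :: "real^'n^'m"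
  assumes transpose_le: "\<And>y. norm (transpose A *v y) \<le> C * norm y" and "C \<ge> 0"
  shows "norm (A *v x) \<le> C * norm x"
proof (cases "A *v x = 0")
  case True
  then show ?thesis
    using \<open>C \<ge> 0\<close> by simp
next
  case False
  have "norm (A *v x) * norm (A *v x) = x \<bullet> (transpose A *v (A *v x))"
    by (metis inner_matrix_vector_mult_adjoint power2_norm_eq_inner power2_eq_square)
  also have "\<dots> \<le> norm x * norm (transpose A *v (A *v x))"
    by (rule norm_cauchy_schwarz)
  also have "\<dots> \<le> norm x * (C * norm (A *v x))"
    by (intro mult_left_mono transpose_le) auto
  finally have "norm (A *v x) * norm (A *v x) \<le> (C * norm x) * norm (A *v x)"
    by (simp add: algebra_simps)
  then show ?thesis
    using False by simp
qed

theorem theorem11: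
  fixes f :: "real^'n \<Rightarrow> real" and g :: "real^'m \<Rightarrow> ereal" and A :: "real^'n^'m"
    and \<rho> L amin amax \<gamma> \<epsilon> :: real
  assumes "continuously_differentiable f"
    and "\<rho> > 0" and "strongly_convex \<rho> f" and "strongly_smooth L f"
    and "convex_ereal g" and "closed_ereal g" and "proper_ereal g"
    and "amin > 0" and "amax > 0"
    and "amin *\<^sub>R mat 1 \<preceq> A ** transpose A" and "A ** transpose A \<preceq> amax *\<^sub>R mat 1"
    and "\<gamma> > 0" and "0 < \<epsilon>" and "\<epsilon> < 1 / sqrt amax"
  shows "(\<exists>c \<alpha> \<kappa>. nlp_optimal \<rho> L amin amax \<gamma> \<epsilon> (c, \<alpha>, \<kappa>)) \<and>
    (\<forall>c \<alpha> \<kappa>. nlp_optimal \<rho> L amin amax \<gamma> \<epsilon> (c, \<alpha>, \<kappa>) \<longrightarrow>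
       \<alpha> > 0 \<and> c > 0 \<and>
       strongly_inf_contracting (contraction_metric A \<alpha>) c (primal_dual_dynamics f g A \<gamma>))"
proof (intro conjI allI impI)
  have smooth: "L-lipschitz_on UNIV (gradient f)"
    using assms(4) by (simp add: strongly_smooth_def)
  then have "L \<ge> 0"
    by (rule lipschitz_on_nonneg)
  then show "\<exists>c \<alpha> \<kappa>. nlp_optimal \<rho> L amin amax \<gamma> \<epsilon> (c, \<alpha>, \<kappa>)"
    using assms by (intro nlp_optimal_exists) auto
  fix c \<alpha> \<kappa> assume opt: "nlp_optimal \<rho> L amin amax \<gamma> \<epsilon> (c, \<alpha>, \<kappa>)"
  then have feas: "nlp_feasible \<rho> L amin amax \<gamma> \<epsilon> (c, \<alpha>, \<kappa>)"
    by (simp add: nlp_optimal_def is_arg_max_def)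
  show "c > 0" "\<alpha> > 0"
    using nlp_optimal_positive[OF opt] assms by auto
  let ?T' = "\<lambda>y. transpose A *v y" and ?P = "contraction_metric A \<alpha>"
  have lower: "amin * (norm y)\<^sup>2 \<le> (norm (?T' y))\<^sup>2" for y
    using loewner_le_inner[OF assms(10), of y] by (simp only: scaled_identity_inner gram_inner)
  have upper2: "(norm (?T' y))\<^sup>2 \<le> amax * (norm y)\<^sup>2" for y
    using loewner_le_inner[OF assms(11), of y] by (simp only: scaled_identity_inner gram_inner)
  have upper: "norm (?T' y) \<le> sqrt amax * norm y" for y
    using real_sqrt_le_mono[OF upper2[of y]] by (simp add: real_sqrt_mult)
  have upper': "norm (A *v x) \<le> sqrt amax * norm x" for x
  proof (rule norm_matrix_vector_mult_le_of_transpose)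
    show "sqrt amax \<ge> 0"
      using \<open>amax > 0\<close> by simp
  qed (rule upper)
  have "amin \<le> amax"
    using order_trans[OF lower upper2, of "axis undefined 1"]
    by (simp del: transpose_matrix_vector)

  let ?v = "gradient (moreau_envelope \<gamma> g)"
  have coco: "\<gamma> * (norm (?v x - ?v y))\<^sup>2 \<le> (?v x - ?v y) \<bullet> (x - y)" for x y
    using assms by (intro gradient_moreau_envelope_cocoercive) auto
  have pos_def: "pos_def ?P"
  proof (rule pos_def_contraction_metric)
    have "\<alpha> < 1 / sqrt amax"
      using feas \<open>0 < \<epsilon>\<close> by (simp add: nlp_feasible_def)
    then show "\<alpha> * sqrt amax < 1"
      using \<open>amax > 0\<close> by (simp add: field_simps)
  next
    show "\<alpha> \<ge> 0" "amax \<ge> 0"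
      using \<open>\<alpha> > 0\<close> \<open>amax > 0\<close> by simp_all
  qed (rule upper')

  have "continuous_on UNIV (primal_dual_dynamics f g A \<gamma>)"
  proof -
    have v: "continuous_on UNIV ?v"
    proof (rule lipschitz_on_continuous_on)
      show "(1 / \<gamma>)-lipschitz_on UNIV ?v"
        using cocoercive_norm_le[OF coco] \<open>\<gamma> > 0\<close>
        by (intro lipschitz_onI) (auto simp: dist_norm)
    qed
    have f: "continuous_on UNIV (gradient f)"
      using smooth by (rule lipschitz_on_continuous_on)
    have arg: "continuous_on UNIV (\<lambda>z. A *v left_vec z + \<gamma> *\<^sub>R right_vec z)"
      by (intro continuous_intros continuous_on_left_vec continuous_on_right_vec
          matrix_vector_mult_linear_continuous_on[THEN continuous_on_compose2]) auto
    note vz = continuous_on_compose2[OF v arg]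
    show ?thesis
      unfolding primal_dual_dynamics_def Let_def
      by (intro continuous_on_join_vec continuous_intros vz continuous_on_right_vec
          continuous_on_compose2[OF f continuous_on_left_vec]
          continuous_on_compose2[OF matrix_vector_mult_linear_continuous_on vz]) auto
  qed

  moreover have "(primal_dual_dynamics f g A \<gamma> z1 - primal_dual_dynamics f g A \<gamma> z2) \<bullet> (?P *v (z1 - z2))
      \<le> - c * (weighted_norm ?P (z1 - z2))\<^sup>2" for z1 z2
  proof -
    define x where "x = left_vec (z1 - z2)"
    define y where "y = right_vec (z1 - z2)"
    define p where "p = gradient f (left_vec z1) - gradient f (left_vec z2)"
    define v where "v = ?v (A *v left_vec z1 + \<gamma> *\<^sub>R right_vec z1)
      - ?v (A *v left_vec z2 + \<gamma> *\<^sub>R right_vec z2)"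
    have "primal_dual_dynamics f g A \<gamma> z1 - primal_dual_dynamics f g A \<gamma> z2
        = join_vec (- p - ?T' v) (\<gamma> *\<^sub>R (v - y))"
      unfolding primal_dual_dynamics_def Let_def join_vec_diff p_def v_def y_def right_vec_diff
      by (simp add: matrix_vector_mult_diff_distrib algebra_simps del: transpose_matrix_vector)
    then have "(primal_dual_dynamics f g A \<gamma> z1 - primal_dual_dynamics f g A \<gamma> z2) \<bullet> (?P *v (z1 - z2))
        = (- p - ?T' v) \<bullet> (x + \<alpha> *\<^sub>R ?T' y) + \<gamma> * ((v - y) \<bullet> (\<alpha> *\<^sub>R (A *v x) + y))"
      by (simp only: contraction_metric_mult_vec inner_join_vec left_join_vec right_join_vec
          x_def[symmetric] y_def[symmetric] inner_scaleR_left)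
    also have "\<dots> \<le> - c * ((norm x)\<^sup>2 + 2 * \<alpha> * ((A *v x) \<bullet> y) + (norm y)\<^sup>2)"
    proof (rule primal_dual_dissipation[OF matrix_vector_mul_linear inner_matrix_vector_mult_adjoint
          lower upper upper' _ _ _ \<open>amin > 0\<close> \<open>amin \<le> amax\<close> \<open>\<gamma> > 0\<close> \<open>L \<ge> 0\<close> feas \<open>\<alpha> > 0\<close>])
      show "\<rho> * (norm x)\<^sup>2 \<le> p \<bullet> x"
        unfolding x_def p_def left_vec_diff using assms(1,3)
        by (intro strongly_convex_imp_gradient_strongly_monotone)
          (auto simp: continuously_differentiable_def)
      show "norm p \<le> L * norm x"
        unfolding x_def p_def left_vec_diff using lipschitz_onD[OF smooth] by (simp add: dist_norm)
      have "A *v x + \<gamma> *\<^sub>R y = (A *v left_vec z1 + \<gamma> *\<^sub>R right_vec z1)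
          - (A *v left_vec z2 + \<gamma> *\<^sub>R right_vec z2)"
        unfolding x_def y_def left_vec_diff right_vec_diff
        by (simp add: matrix_vector_mult_diff_distrib algebra_simps)
      then show "\<gamma> * (norm v)\<^sup>2 \<le> v \<bullet> (A *v x + \<gamma> *\<^sub>R y)"
        unfolding v_def using coco by simp
    qed
    also have "\<dots> = - c * ((z1 - z2) \<bullet> (?P *v (z1 - z2)))"
      by (simp only: contraction_metric_quadratic_form x_def y_def)
    also have "(z1 - z2) \<bullet> (?P *v (z1 - z2)) = (weighted_norm ?P (z1 - z2))\<^sup>2"
    proof -
      have "0 \<le> (z1 - z2) \<bullet> (?P *v (z1 - z2))"
        using pos_def unfolding pos_def_def by (cases "z1 - z2 = 0") (auto intro: less_imp_le)
      then show ?thesis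
        by (simp add: weighted_norm_def)
    qed
    finally show ?thesis .
  qed
  ultimately show "strongly_inf_contracting ?P c (primal_dual_dynamics f g A \<gamma>)"
    using pos_def \<open>c > 0\<close> by (simp add: strongly_inf_contracting_def)
qed

end
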